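(* For every integer $n \geq 0$ and every $i \in \{0,1,2\}$ we have $r_{3,i}(n) - r_{3,i+1}(n) \in \{-1, 0, 1\}$, where $r_{m,i}(n)$ denotes the number of Fibonacci partitions of $n$ whose number of parts is congruent to $i$ modulo $m$ (so that $r_{3,3}(n) = r_{3,0}(n)$).
   Context: The Fibonacci numbers are $F_0 = 0$, $F_1 = 1$, and $F_n = F_{n-1} + F_{n-2}$ for $n \geq 2$. A Fibonacci partition of a natural number $n \ge 0$ is a way of writing $n$ as a sum of distinct Fibonacci numbers $F_j$ with $j \geq 2$, where order does not matter; equivalently, it is a finite set $S \subseteq \{2,3,4,\ldots\}$ with $\sum_{j \in S} F_j = n$. Its number of parts is $|S|$. (The total number of Fibonacci partitions of $n$ is the coefficient of $X^n$ in $\prod_{j \geq 2} (1 + X^{F_j})$; the empty set is the unique Fibonacci partition of $0$.) For integers $m \geq 1$ and $i$, $r_{m,i}(n)$ is the number of Fibonacci partitions of $n$ having number of parts congruent to $i \pmod m$. *)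

theory Defs
  imports "HOL-Number_Theory.Number_Theory"
begin

definition fib_partitions :: "nat \<Rightarrow> nat set set" where
  "fib_partitions n = {S. finite S \<and> S \<subseteq> {2..} \<and> (\<Sum>j\<in>S. fib j) = n}"

definition fib_partition_count :: "nat \<Rightarrow> int \<Rightarrow> nat \<Rightarrow> nat" where
  "fib_partition_count m i n = card {S \<in> fib_partitions n. [int (card S) = i] (mod int m)}"

lemma le_Suc_fib: "j \<le> Suc (fib j)"
proof (induction j rule: fib.induct)
  case (3 k)
  then show ?case
    by (cases k) (use fib_neq_0_nat[of k] in auto)
qed auto

text \<open>There are finitely many partitions, so the cardinality in the definition of
  \<^const>\<open>fib_partition_count\<close> is a genuine count.\<close>

lemma finite_fib_partitions: "finite (fib_partitions n)"
proof (rule finite_subset)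
  show "fib_partitions n \<subseteq> Pow {..Suc n}"
  proof (intro subsetI PowI)
    fix S j assume "S \<in> fib_partitions n" "j \<in> S"
    then have "fib j \<le> n"
      by (auto simp: fib_partitions_def intro: member_le_sum)
    then show "j \<in> {..Suc n}"
      using le_Suc_fib[of j] by simp
  qed
qed simp

end

theory Submission
  imports Defs Complex_Main
begin

text \<open>
  Let \<open>W\<^sub>k(n)\<close> be the sum of \<open>z\<^bsup>|S|\<^esup>\<close> over the sets \<open>S \<subseteq> {2..k}\<close> with \<open>\<Sum>j\<in>S. F\<^sub>j = n\<close>. For
  \<open>n < F\<^sub>k\<^sub>+\<^sub>1\<close> the pair \<open>(g, h) = (W\<^sub>k(n), W\<^sub>k(n + F\<^sub>k\<^sub>+\<^sub>1))\<close> arises from such a pair for a smaller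
  \<open>k\<close> by one of the maps \<open>(g, h) \<mapsto> (g, zh + z\<^sup>2g)\<close>, \<open>(h + zg, z\<^sup>2h)\<close>, \<open>(h + zg, 0)\<close>. If \<open>z = \<omega>\<close> is a
  primitive cube root of unity, these maps preserve, up to a common factor of modulus at most
  \<open>1\<close>, the set of pairs \<open>(1, 0)\<close>, \<open>(1, \<omega>\<^sup>2)\<close>, \<open>(1, -\<omega>)\<close>, \<open>(0, 1)\<close>. Hence
  \<open>|r\<^sub>0 + r\<^sub>1\<omega> + r\<^sub>2\<omega>\<^sup>2| \<le> 1\<close>, that is, \<open>(r\<^sub>0 - r\<^sub>1)\<^sup>2 + (r\<^sub>1 - r\<^sub>2)\<^sup>2 + (r\<^sub>2 - r\<^sub>0)\<^sup>2 \<le> 2\<close>, so none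
  of the integers \<open>r\<^sub>i - r\<^sub>i\<^sub>+\<^sub>1\<close> exceeds \<open>1\<close> in absolute value.
\<close>

section \<open>Weights with bounded largest index\<close>

definition fib_weight :: "'a::comm_semiring_1 \<Rightarrow> nat \<Rightarrow> nat \<Rightarrow> 'a" where
  "fib_weight z k n = (\<Sum>S | S \<subseteq> {2..k} \<and> (\<Sum>j\<in>S. fib j) = n. z ^ card S)"

text \<open>For \<open>k \<ge> 1\<close> the full sum \<open>F\<^sub>2 + ... + F\<^sub>k\<close>
  telescopes to \<open>F\<^sub>k\<^sub>+\<^sub>2 - 2\<close>.\<close>

lemma sum_fib_subset_less:
  assumes "S \<subseteq> {2..k}"
  shows "(\<Sum>j\<in>S. fib j) < fib (k + 2)"
proof -
  have "(\<Sum>j\<in>{2..k}. fib j) < fib (k + 2)"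
    by (induction k) (auto simp: atLeastAtMostSuc_conv)
  moreover have "(\<Sum>j\<in>S. fib j) \<le> (\<Sum>j\<in>{2..k}. fib j)"
    using assms by (intro sum_mono2) auto
  ultimately show ?thesis by simp
qed

lemma fib_weight_eq_0:
  assumes "fib (k + 2) \<le> n"
  shows "fib_weight z k n = 0"
proof -
  have "(\<Sum>j\<in>S. fib j) \<noteq> n" if "S \<subseteq> {2..k}" for S
    using assms sum_fib_subset_less[OF that] by linarith
  then have "{S. S \<subseteq> {2..k} \<and> (\<Sum>j\<in>S. fib j) = n} = {}"
    by blast
  then show ?thesis
    by (simp only: fib_weight_def sum.empty)
qed

lemma fib_weight_one: "fib_weight z (Suc 0) n = (if n = 0 then 1 else 0)"
proof -
  have "{S. S \<subseteq> {2..Suc 0} \<and> (\<Sum>j\<in>S. fib j) = n} = (if n = 0 then {{}} else {})"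
    by auto
  then show ?thesis
    by (simp add: fib_weight_def)
qed

lemma subset_atLeastAtMost_Suc_iff: "Suc k \<notin> S \<Longrightarrow> S \<subseteq> {m..Suc k} \<longleftrightarrow> S \<subseteq> {m..k}"
  unfolding subset_iff atLeastAtMost_iff le_Suc_eq by blast

lemma fib_weight_Suc_less:
  assumes "n < fib (Suc k)"
  shows "fib_weight z (Suc k) n = fib_weight z k n"
proof -
  have "Suc k \<notin> S" if "S \<subseteq> {2..Suc k}" "(\<Sum>j\<in>S. fib j) = n" for S
    using that assms member_le_sum[of "Suc k" S fib] finite_subset[OF that(1)] by fastforce
  then have "{S. S \<subseteq> {2..Suc k} \<and> (\<Sum>j\<in>S. fib j) = n} = {S. S \<subseteq> {2..k} \<and> (\<Sum>j\<in>S. fib j) = n}"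
    by (metis atLeastAtMost_iff not_less_eq_eq order_refl subset_atLeastAtMost_Suc_iff subset_iff)
  then show ?thesis
    by (simp add: fib_weight_def)
qed

text \<open>Split by whether \<open>Suc k\<close> is a part; removing it costs a factor
  \<open>z\<close>. The bound \<open>k \<ge> 1\<close> makes \<open>Suc k\<close> an admissible
  index.\<close>

lemma fib_weight_Suc_add:
  assumes "k \<ge> 1"
  shows "fib_weight z (Suc k) (n + fib (Suc k)) =
           fib_weight z k (n + fib (Suc k)) + z * fib_weight z k n"
proof -
  define A where "A k n = {S. S \<subseteq> {2..k} \<and> (\<Sum>j\<in>S. fib j) = n}" for k n
  have fin: "finite (A k n)" for k n
    unfolding A_def by (rule finite_subset[of _ "Pow {2..k}"]) auto
  have notin: "Suc k \<notin> S" "finite S" if "S \<in> A k m" for S m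
    using that by (auto simp: A_def intro: finite_subset)
  have split: "A (Suc k) (n + fib (Suc k)) = A k (n + fib (Suc k)) \<union> insert (Suc k) ` A k n"
  proof (intro subset_antisym subsetI)
    fix S assume S: "S \<in> A (Suc k) (n + fib (Suc k))"
    show "S \<in> A k (n + fib (Suc k)) \<union> insert (Suc k) ` A k n"
    proof (cases "Suc k \<in> S")
      case True
      have "finite S" using S by (auto simp: A_def intro: finite_subset)
      then have "S - {Suc k} \<in> A k n"
        using S True by (auto simp: A_def sum.remove[of S "Suc k" fib] subset_iff le_Suc_eq)
      then show ?thesis using True by (auto simp: insert_absorb intro!: image_eqI[of _ _ "S - {Suc k}"])
    next
      case False
      then show ?thesis using S by (simp add: A_def subset_atLeastAtMost_Suc_iff)
    qed
  next
    fix S assume "S \<in> A k (n + fib (Suc k)) \<union> insert (Suc k) ` A k n"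
    then consider "S \<in> A k (n + fib (Suc k))" | T where "S = insert (Suc k) T" "T \<in> A k n"
      by blast
    then show "S \<in> A (Suc k) (n + fib (Suc k))"
    proof cases
      case 1
      then show ?thesis
        by (auto simp: A_def subset_iff le_Suc_eq)
    next
      case 2
      then have "(\<Sum>j\<in>S. fib j) = n + fib (Suc k)"
        using notin[of T] by (simp add: A_def)
      with 2 assms show ?thesis
        by (auto simp: A_def subset_iff le_Suc_eq)
    qed
  qed
  have "inj_on (insert (Suc k)) (A k n)"
    using notin(1) by (intro inj_onI) (metis insert_ident)
  moreover have "A k (n + fib (Suc k)) \<inter> insert (Suc k) ` A k n = {}"
    using notin(1) by auto
  ultimately have "(\<Sum>S\<in>A (Suc k) (n + fib (Suc k)). z ^ card S) =
      (\<Sum>S\<in>A k (n + fib (Suc k)). z ^ card S) + (\<Sum>S\<in>A k n. z ^ card (insert (Suc k) S))"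
    by (simp add: split fin sum.union_disjoint sum.reindex)
  also have "(\<Sum>S\<in>A k n. z ^ card (insert (Suc k) S)) = z * (\<Sum>S\<in>A k n. z ^ card S)"
    using notin by (simp add: sum_distrib_left)
  finally show ?thesis
    by (simp add: fib_weight_def A_def)
qed

section \<open>Recursion for pairs of weights\<close>

definition fib_weight_pair :: "'a::comm_semiring_1 \<Rightarrow> nat \<Rightarrow> nat \<Rightarrow> 'a \<times> 'a" where
  "fib_weight_pair z k n = (fib_weight z k n, fib_weight z k (n + fib (Suc k)))"

text \<open>In the second component the target is at least \<open>F\<^sub>k\<^sub>+\<^sub>3\<close>,
  out of reach of parts up to index \<open>k + 1\<close>. So part \<open>k + 2\<close> is forced,
  and splitting on part \<open>k + 1\<close> leaves \<open>z * (h + z * g)\<close>.\<close>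

lemma fib_weight_pair_less:
  assumes "k \<ge> 1" "n < fib (Suc k)" "fib_weight_pair z k n = (g, h)"
  shows "fib_weight_pair z (Suc (Suc k)) n = (g, z * h + z\<^sup>2 * g)"
proof -
  have "fib (Suc k) \<le> fib (Suc (Suc k))"
    by simp
  then have "fib_weight z (Suc (Suc k)) n = fib_weight z k n"
    using assms(2) by (simp add: fib_weight_Suc_less)
  moreover have "fib_weight z (Suc (Suc k)) (n + fib (Suc k) + fib (Suc (Suc k))) =
      z * fib_weight z (Suc k) (n + fib (Suc k))"
    by (subst fib_weight_Suc_add) (use assms in \<open>auto simp: fib_weight_eq_0\<close>)
  ultimately show ?thesis
    using assms
    by (simp add: fib_weight_pair_def fib_weight_Suc_add algebra_simps power2_eq_square)
qed

text \<open>In the first component part \<open>k + 2\<close> is too large, and part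
  \<open>k + 1\<close> is optional. In the second both are forced, which gives the factor
  \<open>z\<^sup>2\<close>.\<close>

lemma fib_weight_pair_between:
  assumes "k \<ge> 1" "n < fib k" "fib_weight_pair z k n = (g, h)"
  shows "fib_weight_pair z (Suc (Suc k)) (n + fib (Suc k)) = (h + z * g, z\<^sup>2 * h)"
proof -
  let ?m = "n + fib (Suc k)"
  have "fib_weight z (Suc (Suc k)) ?m = fib_weight z (Suc k) ?m"
    using assms(2) by (intro fib_weight_Suc_less) simp
  moreover have "fib_weight z (Suc (Suc k)) (?m + fib (Suc k) + fib (Suc (Suc k))) =
      z * fib_weight z (Suc k) (?m + fib (Suc k))"
    by (subst fib_weight_Suc_add) (use assms in \<open>auto simp: fib_weight_eq_0\<close>)
  moreover have "fib k \<le> fib (Suc k)"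
    by (rule fib_mono) simp
  then have "fib_weight z (Suc k) (?m + fib (Suc k)) = z * fib_weight z k ?m"
    by (subst fib_weight_Suc_add) (use assms in \<open>auto simp: fib_weight_eq_0\<close>)
  ultimately show ?thesis
    using assms
    by (simp add: fib_weight_pair_def fib_weight_Suc_add algebra_simps power2_eq_square)
qed

text \<open>Only one index is added here; the second target is then at least
  \<open>F\<^sub>k\<^sub>+\<^sub>3\<close> and cannot be reached.\<close>

lemma fib_weight_pair_ge:
  assumes "k \<ge> 1" "fib_weight_pair z k n = (g, h)"
  shows "fib_weight_pair z (Suc k) (n + fib (Suc k)) = (h + z * g, 0)"
  using assms by (simp add: fib_weight_pair_def fib_weight_Suc_add fib_weight_eq_0)

section \<open>Invariant pairs for a primitive cube root of unity\<close>

definition cube_pair :: "complex \<Rightarrow> complex \<times> complex \<Rightarrow> bool" where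
  "cube_pair z p \<longleftrightarrow> (\<exists>e. norm e \<le> 1 \<and> p \<in> {(e, 0), (e, e * z\<^sup>2), (e, - e * z), (0, e)})"

lemma cube_pairI:
  "norm e \<le> 1 \<Longrightarrow> p \<in> {(e, 0), (e, e * z\<^sup>2), (e, - e * z), (0, e)} \<Longrightarrow> cube_pair z p"
  unfolding cube_pair_def by blast

lemma
  fixes z :: complex
  assumes z: "1 + z + z\<^sup>2 = 0" and p: "cube_pair z (g, h)"
  shows cube_pair_less: "cube_pair z (g, z * h + z\<^sup>2 * g)"
    and cube_pair_between: "cube_pair z (h + z * g, z\<^sup>2 * h)"
    and cube_pair_ge: "cube_pair z (h + z * g, 0)"
proof -
  have z2: "z\<^sup>2 = - 1 - z"
    using z by (simp add: algebra_simps add_eq_0_iff)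
  \<comment> \<open>Both associations are needed to rewrite every polynomial in \<open>z\<close> to
    a linear one.\<close>
  have zz: "z * z = - 1 - z" "z * (z * x) = - x - z * x" for x
  proof -
    show zz: "z * z = - 1 - z"
      using z2 by (simp add: power2_eq_square)
    show "z * (z * x) = - x - z * x"
      unfolding mult.assoc[symmetric] zz by (simp add: algebra_simps)
  qed
  have "z ^ 3 = 1"
    by (simp add: power3_eq_cube zz algebra_simps)
  then have nz: "norm z = 1"
    by (metis norm_one norm_power norm_ge_zero power_eq_1_iff zero_neq_numeral)
  obtain e where e: "norm e \<le> 1"
    and "(g, h) \<in> {(e, 0), (e, e * z\<^sup>2), (e, - e * z), (0, e)}"
    using p by (auto simp: cube_pair_def)
  then consider "g = e" "h = 0" | "g = e" "h = e * z\<^sup>2" | "g = e" "h = - e * z" | "g = 0" "h = e"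
    by auto
  then have "cube_pair z (g, z * h + z\<^sup>2 * g) \<and> cube_pair z (h + z * g, z\<^sup>2 * h) \<and>
    cube_pair z (h + z * g, 0)"
  proof cases
    case 1
    with e nz show ?thesis
      by (auto intro: cube_pairI[of e] cube_pairI[of "z * e"] simp: norm_mult)
  next
    case 2
    have eqs: "z * h + z\<^sup>2 * g = - e * z" "h + z * g = - e" "z\<^sup>2 * h = e * z"
      unfolding 2 by (simp_all add: z2 zz algebra_simps)
    show ?thesis
      unfolding eqs using 2 e
      by (auto intro: cube_pairI[of e] cube_pairI[of "- e"])
  next
    case 3
    \<comment> \<open>Here \<open>h + z * g\<close> cancels, so the third map gives
      \<open>(0, 0)\<close>; this is covered by the scalar \<open>e = 0\<close>.\<close>
    have eqs: "z * h + z\<^sup>2 * g = 0" "h + z * g = 0" "z\<^sup>2 * h = - e"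
      unfolding 3 by (simp_all add: z2 zz algebra_simps)
    show ?thesis
      unfolding eqs using 3 e
      by (auto intro: cube_pairI[of e] cube_pairI[of "- e"] cube_pairI[of 0])
  next
    case 4
    with e nz show ?thesis
      by (auto intro: cube_pairI[of e] cube_pairI[of "z * e"] cube_pairI[of "z\<^sup>2 * e"]
          simp: norm_mult norm_power)
  qed
  then show "cube_pair z (g, z * h + z\<^sup>2 * g)" "cube_pair z (h + z * g, z\<^sup>2 * h)"
    "cube_pair z (h + z * g, 0)"
    by auto
qed

text \<open>The three maps cover the three ranges of \<open>n\<close> cut at the two preceding
  Fibonacci numbers. Two of them go back two indices, hence induction along the recursion of
  \<open>fib\<close>.\<close>

lemma cube_pair_fib_weight_pair:
  assumes z: "1 + z + z\<^sup>2 = 0" and "n < fib (Suc (Suc k))"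
  shows "cube_pair z (fib_weight_pair z (Suc k) n)"
  using assms(2)
proof (induction k arbitrary: n rule: fib.induct)
  case 1
  then show ?case
    by (auto intro!: cube_pairI[of 1] simp: fib_weight_pair_def fib_weight_one)
next
  case 2
  have base: "cube_pair z (fib_weight_pair z (Suc 0) 0)"
    by (auto intro!: cube_pairI[of 1] simp: fib_weight_pair_def fib_weight_one)
  show ?case
  \<comment> \<open>At index 2 only \<open>n = 0\<close> and \<open>n = 1\<close> occur; the latter
    comes from index 1 by the third map.\<close>
  proof (cases "n = 0")
    case True
    then show ?thesis
      using fib_weight_Suc_less[of 0 "Suc 0" z] fib_weight_eq_0[of "Suc 0" 2 z]
        fib_weight_Suc_add[of "Suc 0" z 1]
      by (auto intro!: cube_pairI[of 1] simp: fib_weight_pair_def fib_weight_one numeral_2_eq_2)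
  next
    case False
    with 2 have "n = 0 + fib (Suc (Suc 0))"
      by simp
    then show ?thesis
      using fib_weight_pair_ge[of "Suc 0" z 0] cube_pair_ge[OF z] base
      by (metis One_nat_def order_refl surj_pair)
  qed
next
  case (3 k)
  consider (less) "n < fib (Suc (Suc k))" | (between) "fib (Suc (Suc k)) \<le> n" "n < fib (Suc (Suc (Suc k)))"
    | (ge) "fib (Suc (Suc (Suc k))) \<le> n"
    by linarith
  then show ?case
  proof cases
    case less
    then have "cube_pair z (fib_weight_pair z (Suc k) n)"
      by (rule 3)
    then show ?thesis
      using fib_weight_pair_less[of "Suc k" n z] cube_pair_less[OF z] less
      by (cases "fib_weight_pair z (Suc k) n") auto
  next
    case between
    define m where "m = n - fib (Suc (Suc k))"
    have n: "n = m + fib (Suc (Suc k))" and m: "m < fib (Suc k)"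
      using between by (auto simp: m_def)
    have "cube_pair z (fib_weight_pair z (Suc k) m)"
      using m by (intro 3) simp
    then show ?thesis
      using fib_weight_pair_between[of "Suc k" m z] cube_pair_between[OF z] m
      unfolding n by (cases "fib_weight_pair z (Suc k) m") auto
  next
    case ge
    define m where "m = n - fib (Suc (Suc (Suc k)))"
    have n: "n = m + fib (Suc (Suc (Suc k)))" and m: "m < fib (Suc (Suc k))"
      using ge "3.prems" by (auto simp: m_def)
    have "cube_pair z (fib_weight_pair z (Suc (Suc k)) m)"
      using m by (intro 3) simp
    then show ?thesis
      using fib_weight_pair_ge[of "Suc (Suc k)" z m] cube_pair_ge[OF z]
      unfolding n by (cases "fib_weight_pair z (Suc (Suc k)) m") auto
  qed
qed

section \<open>From weights to residue classes of the number of parts\<close>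

lemma norm_sum_fib_partitions_le_1:
  fixes z :: complex
  assumes "1 + z + z\<^sup>2 = 0"
  shows "norm (\<Sum>S\<in>fib_partitions n. z ^ card S) \<le> 1"
proof -
  \<comment> \<open>Since \<open>j \<le> F\<^sub>j + 1\<close>, index \<open>n + 1\<close> bounds
    all parts, so the full sum is the first component of a pair.\<close>
  have "S \<subseteq> {2..Suc n}" if "S \<in> fib_partitions n" for S
  proof
    fix j assume "j \<in> S"
    with that have "2 \<le> j" "fib j \<le> n"
      by (auto simp: fib_partitions_def intro: member_le_sum)
    then show "j \<in> {2..Suc n}"
      using le_Suc_fib[of j] by simp
  qed
  then have "fib_partitions n = {S. S \<subseteq> {2..Suc n} \<and> (\<Sum>j\<in>S. fib j) = n}"
    by (auto simp: fib_partitions_def intro: finite_subset)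
  moreover have "n < fib (Suc (Suc n))"
    using le_Suc_fib[of "Suc (Suc n)"] by linarith
  then have "norm (fib_weight z (Suc n) n) \<le> 1"
    using cube_pair_fib_weight_pair[OF assms, of n n]
    by (auto simp: cube_pair_def fib_weight_pair_def)
  ultimately show ?thesis
    by (simp add: fib_weight_def)
qed

lemma sum_fib_partitions_eq:
  fixes z :: "'a::comm_ring_1"
  assumes z: "z ^ 3 = 1"
  shows "(\<Sum>S\<in>fib_partitions n. z ^ card S) = of_nat (fib_partition_count 3 0 n) +
    of_nat (fib_partition_count 3 1 n) * z + of_nat (fib_partition_count 3 2 n) * z\<^sup>2"
proof -
  have count: "of_nat (fib_partition_count 3 i n) =
    (\<Sum>S\<in>fib_partitions n. if [int (card S) = i] (mod 3) then 1 else (0::'a))" for i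
    by (simp add: fib_partition_count_def finite_fib_partitions flip: sum.inter_filter)
  have pow: "z ^ c = (if [int c = 0] (mod 3) then 1 else 0) + (if [int c = 1] (mod 3) then 1 else 0) * z +
    (if [int c = 2] (mod 3) then 1 else 0) * z\<^sup>2" for c
  proof -
    have "z ^ c = z ^ (3 * (c div 3) + c mod 3)"
      by simp
    also have "\<dots> = z ^ (c mod 3)"
      unfolding power_add power_mult z by simp
    finally have c: "z ^ c = z ^ (c mod 3)" .
    have "int c mod 3 = int (c mod 3)"
      by (simp add: zmod_int)
    moreover have "c mod 3 = 0 \<or> c mod 3 = 1 \<or> c mod 3 = 2"
      by linarith
    ultimately show ?thesis
      unfolding c by (auto simp: cong_def)
  qed
  show ?thesis
    unfolding count sum_distrib_right sum.distrib[symmetric] by (intro sum.cong refl pow)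
qed

lemma fib_partition_count_cong:
  "[i = j] (mod int m) \<Longrightarrow> fib_partition_count m i n = fib_partition_count m j n"
  by (simp add: fib_partition_count_def cong_def)

theorem theorem2:
  fixes n :: nat and i :: int
  assumes "i \<in> {0, 1, 2}"
  shows "int (fib_partition_count 3 i n) - int (fib_partition_count 3 (i + 1) n) \<in> {-1, 0, 1}"
proof -
  define a b c where "a = int (fib_partition_count 3 0 n)" and "b = int (fib_partition_count 3 1 n)"
    and "c = int (fib_partition_count 3 2 n)"
  define \<omega> where "\<omega> = Complex (- 1 / 2) (sqrt 3 / 2)"
  have \<omega>2: "\<omega>\<^sup>2 = Complex (- 1 / 2) (- sqrt 3 / 2)"
    by (simp add: \<omega>_def power2_eq_square complex_eq_iff)
  have "\<omega> ^ 3 = 1"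
    unfolding power3_eq_cube power2_eq_square[symmetric] \<omega>2
    by (simp add: \<omega>_def complex_eq_iff)
  moreover have "1 + \<omega> + \<omega>\<^sup>2 = 0"
    unfolding \<omega>2 by (simp add: \<omega>_def complex_eq_iff)
  ultimately have "norm (of_int a + of_int b * \<omega> + of_int c * \<omega>\<^sup>2) \<le> 1"
    using norm_sum_fib_partitions_le_1[of \<omega> n] sum_fib_partitions_eq[of \<omega> n]
    by (simp add: a_def b_def c_def)
  then have "(norm (of_int a + of_int b * \<omega> + of_int c * \<omega>\<^sup>2))\<^sup>2 \<le> 1"
    by (simp add: power_le_one)
  \<comment> \<open>The squared norm is
    \<open>a\<^sup>2 + b\<^sup>2 + c\<^sup>2 - a * b - b * c - c * a\<close>.\<close>
  moreover have "2 * (norm (of_int a + of_int b * \<omega> + of_int c * \<omega>\<^sup>2))\<^sup>2 =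
    of_int ((a - b)\<^sup>2 + (b - c)\<^sup>2 + (c - a)\<^sup>2)"
    unfolding cmod_power2 \<omega>2 by (simp add: \<omega>_def power2_eq_square field_simps)
  ultimately have "real_of_int ((a - b)\<^sup>2 + (b - c)\<^sup>2 + (c - a)\<^sup>2) \<le> 2"
    by linarith
  then have le: "(a - b)\<^sup>2 + (b - c)\<^sup>2 + (c - a)\<^sup>2 \<le> 2"
    by linarith
  have small: "x \<in> {-1, 0, 1}" if "x\<^sup>2 \<le> 2" for x :: int
  proof -
    have "\<bar>x\<bar>\<^sup>2 < 2\<^sup>2"
      using that by simp
    then have "\<bar>x\<bar> < 2"
      by (rule power2_less_imp_less) simp
    then show ?thesis by auto
  qed
  have "a - b \<in> {-1, 0, 1}" "b - c \<in> {-1, 0, 1}" "c - a \<in> {-1, 0, 1}"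
    using le zero_le_power2[of "a - b"] zero_le_power2[of "b - c"] zero_le_power2[of "c - a"]
    by (intro small; linarith)+
  \<comment> \<open>For \<open>i = 2\<close> the index \<open>i + 1\<close> wraps around to residue
    0.\<close>
  moreover have "fib_partition_count 3 3 n = fib_partition_count 3 0 n"
    by (rule fib_partition_count_cong) (simp add: cong_def)
  moreover have "i = 0 \<or> i = 1 \<or> i = 2"
    using assms by blast
  moreover have "(0 + 1 :: int) = 1" "(1 + 1 :: int) = 2" "(2 + 1 :: int) = 3"
    by simp_all
  ultimately show ?thesis
    unfolding a_def b_def c_def by metis
qed

end
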